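(* Let $P$ be a finite irreducible Markov kernel on $V$ with stationary distribution $\pi$, and let $\pi_*=\min_{v\in V}\pi(v)$. Let $f:[0,1]\to\mathbb R_+$ be a decreasing function, let $\mathrm{dist}$ be a distance such that $$\mathrm{dist}(P^n(x,\cdot),\pi)\le\hat{\mathbb E}_n f(\pi(S_n))\quad\text{whenever } x\in V \text{ and } S_0=\{x\},$$ and let $\tau(\epsilon)$ be the mixing time in this distance. If $x\bigl(1-\mathcal C_{af(a)}(f^{-1}(x))\bigr)$ is convex then $$\tau(\epsilon)\le\left\lceil\int_{\pi_*}^{f^{-1}(\epsilon)}\frac{-f'(x)\,dx}{f(x)\,(1-\mathcal C_{af(a)}(x))}\right\rceil ,$$ while in general $$\tau(\epsilon)\le\left\lceil\int_{f^{-1}(f(\pi_* )/2)}^{f^{-1}(\epsilon/2)}\frac{-2f'(x)\,dx}{f(x)\,(1-\mathcal C_{af(a)}(x))}\right\rceil .$$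
   Context: For $A,B\subset V$, $Q(A,B)=\sum_{x\in A,y\in B}\pi(x)P(x,y)$, $Q(A,y)=Q(A,\{y\})$, and $A_u=\{y\in V:Q(A,y)\ge u\,\pi(y)\}$ for $u\in[0,1]$. The evolving set process moves from $A$ to $A_u$ with $u$ uniform on $[0,1]$; its kernel is $K(A,S)=\mathrm{Prob}(A_u=S)$, and its Doob transform is the chain on sets with kernel $\hat K(S,S')=\frac{\pi(S')}{\pi(S)}K(S,S')$. $S_0,S_1,\dots$ is the chain with kernel $\hat K$, and $\hat{\mathbb E}_n$ is expectation under $\hat K^n$ started at $S_0$. For a function $g:[0,1]\to\mathbb R_+$ non-zero except possibly at $0$ and $1$, the $g$-congestion is $\mathcal C_g(A)=\frac{\int_0^1 g(\pi(A_u))\,du}{g(\pi(A))}$ for $A\subset V$, and the $g$-congestion profile is $\mathcal C_g(r)=\max\{\mathcal C_g(A):\ \pi(A)\le r,\ A\ne\emptyset,V\}$ for $r>0$. $\mathcal C_{af(a)}$ means $\mathcal C_g$ with $g(a)=af(a)$. The inverse $f^{-1}$ and derivative $f'$ are those of the given decreasing function $f$. $\tau(\epsilon)$ is the minimum number of steps $n$ that guarantees $\mathrm{dist}(P^n(x,\cdot),\pi)\le\epsilon$ for every starting state $x\in V$.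
   Formalization: Added, as the claim fails without them: f^{-1} is defined on (0,f(π_* )] (so f(1)=0); C_{af(a)}<1 from π_* up to the upper limit of integration; and, for the general bound, C_{af(a)}(A)≤1 for every nonempty proper A (automatic if af(a) is concave). *)

theory Defs
  imports "HOL-Analysis.Analysis" "HOL-Library.Extended_Nat"
begin

definition markov_kernel :: "('a::finite \<Rightarrow> 'a \<Rightarrow> real) \<Rightarrow> bool" where
  "markov_kernel P \<longleftrightarrow> (\<forall>x y. 0 \<le> P x y) \<and> (\<forall>x. (\<Sum>y\<in>UNIV. P x y) = 1)"

primrec kernel_pow :: "('s::finite \<Rightarrow> 's \<Rightarrow> real) \<Rightarrow> nat \<Rightarrow> 's \<Rightarrow> 's \<Rightarrow> real" where
  "kernel_pow K 0 x y = (if x = y then 1 else 0)"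
| "kernel_pow K (Suc n) x y = (\<Sum>z\<in>UNIV. kernel_pow K n x z * K z y)"

definition irreducible_kernel :: "('a::finite \<Rightarrow> 'a \<Rightarrow> real) \<Rightarrow> bool" where
  "irreducible_kernel P \<longleftrightarrow> (\<forall>x y. \<exists>n. 0 < kernel_pow P n x y)"

definition stationary_distribution :: "('a::finite \<Rightarrow> 'a \<Rightarrow> real) \<Rightarrow> ('a \<Rightarrow> real) \<Rightarrow> bool" where
  "stationary_distribution P \<pi> \<longleftrightarrow>
     (\<forall>x. 0 \<le> \<pi> x) \<and> (\<Sum>x\<in>UNIV. \<pi> x) = 1 \<and> (\<forall>y. (\<Sum>x\<in>UNIV. \<pi> x * P x y) = \<pi> y)"

definition min_mass :: "('a::finite \<Rightarrow> real) \<Rightarrow> real" where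
  "min_mass \<pi> = Min (range \<pi>)"

text \<open>The mass \<open>\<pi>(A)\<close> of a set is written \<open>sum \<pi> A\<close> throughout.\<close>

definition flow :: "('a::finite \<Rightarrow> 'a \<Rightarrow> real) \<Rightarrow> ('a \<Rightarrow> real) \<Rightarrow> 'a set \<Rightarrow> 'a set \<Rightarrow> real" where
  "flow P \<pi> A B = (\<Sum>x\<in>A. \<Sum>y\<in>B. \<pi> x * P x y)"

definition evolve :: "('a::finite \<Rightarrow> 'a \<Rightarrow> real) \<Rightarrow> ('a \<Rightarrow> real) \<Rightarrow> 'a set \<Rightarrow> real \<Rightarrow> 'a set" where
  "evolve P \<pi> A u = {y. u * \<pi> y \<le> flow P \<pi> A {y}}"

definition evolving_set_kernel ::
    "('a::finite \<Rightarrow> 'a \<Rightarrow> real) \<Rightarrow> ('a \<Rightarrow> real) \<Rightarrow> 'a set \<Rightarrow> 'a set \<Rightarrow> real" where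
  "evolving_set_kernel P \<pi> A S =
     measure (uniform_measure lborel {0..1}) {u. evolve P \<pi> A u = S}"

text \<open>
  The Doob transform lives on the nonempty sets: it never enters \<open>{}\<close>, and the row
  of \<open>{}\<close> (a division by zero) is never used when starting from a nonempty set.
\<close>

definition doob_kernel ::
    "('a::finite \<Rightarrow> 'a \<Rightarrow> real) \<Rightarrow> ('a \<Rightarrow> real) \<Rightarrow> 'a set \<Rightarrow> 'a set \<Rightarrow> real" where
  "doob_kernel P \<pi> S S' = sum \<pi> S' / sum \<pi> S * evolving_set_kernel P \<pi> S S'"

definition doob_expectation ::
    "('a::finite \<Rightarrow> 'a \<Rightarrow> real) \<Rightarrow> ('a \<Rightarrow> real) \<Rightarrow> nat \<Rightarrow> 'a set \<Rightarrow> ('a set \<Rightarrow> real) \<Rightarrow> real" where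
  "doob_expectation P \<pi> n S0 h = (\<Sum>S\<in>UNIV. kernel_pow (doob_kernel P \<pi>) n S0 S * h S)"

definition congestion ::
    "('a::finite \<Rightarrow> 'a \<Rightarrow> real) \<Rightarrow> ('a \<Rightarrow> real) \<Rightarrow> (real \<Rightarrow> real) \<Rightarrow> 'a set \<Rightarrow> real" where
  "congestion P \<pi> g A =
     integral {0..1} (\<lambda>u. g (sum \<pi> (evolve P \<pi> A u))) / g (sum \<pi> A)"

text \<open>
  For \<open>r < min_mass \<pi>\<close>, and on a one-point state space, this is the maximum of an
  empty set and hence unspecified.
\<close>

definition congestion_profile ::
    "('a::finite \<Rightarrow> 'a \<Rightarrow> real) \<Rightarrow> ('a \<Rightarrow> real) \<Rightarrow> (real \<Rightarrow> real) \<Rightarrow> real \<Rightarrow> real" where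
  "congestion_profile P \<pi> g r =
     Max {congestion P \<pi> g A | A. sum \<pi> A \<le> r \<and> A \<noteq> {} \<and> A \<noteq> UNIV}"

text \<open>
  The mixing time is \<open>\<infinity>\<close> if no number of steps reaches accuracy \<open>\<epsilon>\<close>. The distance \<open>d\<close>
  is an arbitrary function, so that relative entropy and the like are covered.
\<close>

definition mixing_time ::
    "(('a \<Rightarrow> real) \<Rightarrow> ('a \<Rightarrow> real) \<Rightarrow> real) \<Rightarrow> ('a::finite \<Rightarrow> 'a \<Rightarrow> real) \<Rightarrow> ('a \<Rightarrow> real)
       \<Rightarrow> real \<Rightarrow> enat" where
  "mixing_time d P \<pi> \<epsilon> = Inf (enat ` {n. \<forall>x. d (kernel_pow P n x) \<pi> \<le> \<epsilon>})"

text \<open>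
  The inverse is taken on \<open>(0,1]\<close>: masses of nonempty sets are positive, and
  functions such as \<open>ln (1/a)\<close> or \<open>sqrt ((1-a)/a)\<close> have no finite value at \<open>0\<close>.
\<close>

definition unit_inv :: "(real \<Rightarrow> real) \<Rightarrow> real \<Rightarrow> real" where
  "unit_inv f = the_inv_into {0<..1} f"

end

theory Submission
  imports Defs
begin

text \<open>
  Let \<open>e\<^sub>n\<close> be the Doob expectation of \<open>X = f (\<pi>(S\<^sub>n))\<close>, \<open>C\<close> the congestion profile and
  \<open>k y = 1 - C (f\<^sup>-\<^sup>1 y)\<close>, a nondecreasing function. The Doob step multiplies \<open>f (\<pi>(S))\<close> on
  average by the congestion of \<open>S\<close>, so \<open>e\<^sub>n\<^sub>+\<^sub>1 \<le> e\<^sub>n - E[X k(X)]\<close>. Jensen's inequality bounds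
  \<open>E[X k(X)]\<close> below by \<open>e\<^sub>n k(e\<^sub>n)\<close> in the convex case; in general, restricting to
  \<open>X \<ge> e\<^sub>n/2\<close> gives \<open>(e\<^sub>n/2) k(e\<^sub>n/2)\<close>. In both cases each step before
  reaching \<open>\<epsilon>\<close> uses up at least one unit of the integral, since \<open>ln (y/y') \<ge> 1 - y'/y\<close>.
\<close>

section \<open>Decay of sequences\<close>

text \<open>\<open>- deriv f x / f x\<close> is the derivative of \<open>- ln (f x)\<close>, and its
  integrals are nonnegative because \<open>f\<close> decreases. The second mean value theorem asks
  only for a monotone weight and yields integrability as well. Nothing is assumed about
  \<open>g\<close> at \<open>b\<close>: in the application \<open>1 - C\<close> may vanish
  there.\<close>

lemma integral_log_derivative_weight:
  fixes f g :: "real \<Rightarrow> real"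
  assumes "a \<le> b" and cont: "continuous_on {a..b} f" and pos: "\<And>x. x \<in> {a..b} \<Longrightarrow> 0 < f x"
    and diff: "\<And>x. x \<in> {a<..<b} \<Longrightarrow> f differentiable (at x)"
    and anti: "antimono_on {a..b} f"
    and mono: "mono_on {a..<b} g" and fin: "finite (g ` {a..<b})"
  shows "(\<lambda>x. g x * (- deriv f x / f x)) integrable_on {a..b}"
    and "g a * ln (f a / f b) \<le> integral {a..b} (\<lambda>x. g x * (- deriv f x / f x))"
proof -
  let ?D = "\<lambda>x. - deriv f x / f x"
  have D: "(?D has_integral (- ln (f d) - - ln (f c))) {c..d}" if "a \<le> c" "c \<le> d" "d \<le> b" for c d
  proof (rule fundamental_theorem_of_calculus_interior)
    show "continuous_on {c..d} (\<lambda>x. - ln (f x))"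
      using cont pos that by (intro continuous_intros) (auto intro: continuous_on_subset simp: less_imp_neq[symmetric])
    fix x assume x: "x \<in> {c<..<d}"
    have "(f has_field_derivative deriv f x) (at x)"
      using diff[of x] x that by (auto simp: DERIV_deriv_iff_real_differentiable)
    then have "((\<lambda>x. - ln (f x)) has_real_derivative ?D x) (at x)"
      using pos[of x] x that by (auto intro!: derivative_eq_intros)
    then show "((\<lambda>x. - ln (f x)) has_vector_derivative ?D x) (at x)"
      by (simp add: has_real_derivative_iff_has_vector_derivative)
  qed (use that in auto)
  have D_int: "integral {c..d} ?D = ln (f c) - ln (f d)" if "a \<le> c" "c \<le> d" "d \<le> b" for c d
    using integral_unique[OF D[OF that]] by simp
  have D_nonneg: "0 \<le> integral {c..d} ?D" if "a \<le> c" "c \<le> d" "d \<le> b" for c d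
  proof -
    have "f d \<le> f c" using anti that by (auto simp: monotone_on_def)
    then show ?thesis using D_int[OF that] pos[of d] that by simp
  qed
  \<comment> \<open>A substitute value at \<open>b\<close> that keeps the weight monotone on the
    closed interval; inserting \<open>g a\<close> covers the case \<open>a = b\<close>.\<close>
  define M where "M = Max (insert (g a) (g ` {a..<b}))"
  define g' where "g' x = (if x = b then M else g x)" for x
  have M: "g x \<le> M" if "x \<in> {a..<b}" for x
    unfolding M_def using fin that by (auto intro: Max_ge)
  have "g' x \<le> g' y" if "a \<le> x" "x \<le> y" "y \<le> b" for x y
    using that M[of x] mono by (auto simp: g'_def monotone_on_def)
  then obtain c where c: "c \<in> {a..b}"
    and int': "((\<lambda>x. g' x * ?D x) has_integral (g' a * integral {a..c} ?D + g' b * integral {c..b} ?D)) {a..b}"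
    using second_mean_value_theorem_full[of ?D a b g'] D[of a b] assms(1) by (auto simp: has_integral_integrable)
  have int: "((\<lambda>x. g x * ?D x) has_integral (g' a * integral {a..c} ?D + g' b * integral {c..b} ?D)) {a..b}"
    by (rule has_integral_spike_finite[OF _ _ int', of "{b}"]) (auto simp: g'_def)
  then show "(\<lambda>x. g x * ?D x) integrable_on {a..b}" by blast
  have "g a \<le> g' a" "g a \<le> g' b"
    by (auto simp: g'_def M_def fin)
  \<comment> \<open>Lowering both weights to \<open>g a\<close> merges the two pieces into one
    integral of the logarithmic derivative.\<close>
  then have "g a * integral {a..c} ?D + g a * integral {c..b} ?D
      \<le> g' a * integral {a..c} ?D + g' b * integral {c..b} ?D"
    using c D_nonneg by (intro add_mono mult_right_mono) auto
  also have "g a * integral {a..c} ?D + g a * integral {c..b} ?D = g a * ln (f a / f b)"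
    using D_int[of a c] D_int[of c b] c pos[of a] pos[of b]
    by (simp only: distrib_left[symmetric]) (simp add: ln_div)
  finally show "g a * ln (f a / f b) \<le> integral {a..b} (\<lambda>x. g x * ?D x)"
    by (simp only: integral_unique[OF int])
qed

text \<open>The points \<open>r\<close> with \<open>f r = y n\<close> serve as a clock: from
  \<open>y n\<close> to \<open>y (Suc n)\<close> the point moves right over a stretch whose integral
  is at least \<open>g r * ln (y n / y (Suc n))\<close>, hence at least 1.\<close>

lemma decay_time_le_integral:
  fixes f g :: "real \<Rightarrow> real" and y :: "nat \<Rightarrow> real"
  assumes cont: "continuous_on {L..R} f" and diff: "\<And>x. x \<in> {L<..<R} \<Longrightarrow> f differentiable (at x)"
    and anti: "antimono_on {L..R} f" and fR: "0 < f R"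
    and g_mono: "mono_on {L..<R} g" and g_fin: "finite (g ` {L..<R})" and g_pos: "\<And>r. r \<in> {L..<R} \<Longrightarrow> 0 < g r"
    and y_anti: "antimono y" and y0: "y 0 \<le> f L"
    and step: "\<And>n r. r \<in> {L..<R} \<Longrightarrow> f r = y n \<Longrightarrow> f R < y n \<Longrightarrow> y (Suc n) \<le> y n * (1 - 1 / g r)"
    and LR: "L \<le> R"
  shows "y (nat \<lceil>integral {L..R} (\<lambda>x. g x * (- deriv f x / f x))\<rceil>) \<le> f R"
proof (rule ccontr)
  let ?h = "\<lambda>x. g x * (- deriv f x / f x)"
  define N where "N = nat \<lceil>integral {L..R} ?h\<rceil>"
  assume "\<not> y (nat \<lceil>integral {L..R} ?h\<rceil>) \<le> f R"
  then have yN: "f R < y N" by (simp add: N_def)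
  have y_gt: "f R < y m" if "m \<le> N" for m
    using yN y_anti that by (auto dest: antimonoD intro: less_le_trans)
  have pos: "0 < f x" if "x \<in> {L..R}" for x
  proof -
    have "f R \<le> f x" using anti that by (auto simp: monotone_on_def)
    then show ?thesis using fR by simp
  qed
  have int: "?h integrable_on {a..b}" "g a * ln (f a / f b) \<le> integral {a..b} ?h"
    if "L \<le> a" "a \<le> b" "b \<le> R" for a b
  proof -
    have sub: "{a..b} \<subseteq> {L..R}" "{a..<b} \<subseteq> {L..<R}" using that by auto
    note hyp = \<open>a \<le> b\<close> continuous_on_subset[OF cont sub(1)] pos diff
      monotone_on_subset[OF anti sub(1)] monotone_on_subset[OF g_mono sub(2)]
      finite_subset[OF image_mono[OF sub(2)] g_fin]
    show "?h integrable_on {a..b}" "g a * ln (f a / f b) \<le> integral {a..b} ?h"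
      by (intro integral_log_derivative_weight hyp; use that in auto)+
  qed
  \<comment> \<open>The strict \<open>f R < v\<close> keeps the point off \<open>R\<close>, where
    neither \<open>g\<close> nor \<open>step\<close> is controlled.\<close>
  have ivt: "\<exists>r\<in>{a..<R}. f r = v" if "L \<le> a" "a \<le> R" "f R < v" "v \<le> f a" for a v
  proof -
    have "\<exists>r\<ge>a. r \<le> R \<and> f r = v"
      using that by (intro IVT2') (auto intro: continuous_on_subset[OF cont])
    then show ?thesis using that by (metis atLeastLessThan_iff less_irrefl order_le_less)
  qed
  have "\<exists>r\<in>{L..<R}. f r = y m \<and> m \<le> integral {L..r} ?h" if "m \<le> N" for m
    using that
  proof (induction m)
    case 0
    obtain r where r: "r \<in> {L..<R}" "f r = y 0"
      using ivt[of L "y 0"] y_gt[of 0] y0 LR by auto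
    have "0 \<le> g L * ln (f L / f r)"
      using r y0 g_pos[of L] pos[of r] by (intro mult_nonneg_nonneg ln_ge_zero) auto
    also have "\<dots> \<le> integral {L..r} ?h" using int(2)[of L r] r by auto
    finally show ?case using r by auto
  next
    case (Suc m)
    then obtain r where r: "r \<in> {L..<R}" "f r = y m" "m \<le> integral {L..r} ?h" by auto
    have le: "y (Suc m) \<le> y m" using y_anti by (simp add: antimono_def)
    obtain r' where r': "r' \<in> {r..<R}" "f r' = y (Suc m)"
      using ivt[of r "y (Suc m)"] y_gt[of "Suc m"] le r Suc.prems by auto
    have ypos: "0 < y m" "0 < y (Suc m)" using y_gt[of m] y_gt[of "Suc m"] Suc.prems fR by auto
    have gr: "0 < g r" using g_pos r by auto
    have "y (Suc m) / y m \<le> 1 - 1 / g r"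
      using step[OF r(1,2)] y_gt[of m] Suc.prems ypos by (simp add: field_simps)
    then have "1 / g r \<le> 1 - y (Suc m) / y m" by simp
    also have "\<dots> \<le> - ln (y (Suc m) / y m)"
      using ln_le_minus_one[of "y (Suc m) / y m"] ypos by simp
    also have "\<dots> = ln (f r / f r')" using ypos r r' by (simp add: ln_div)
    finally have "1 \<le> g r * ln (f r / f r')" using gr by (simp add: field_simps)
    also have "\<dots> \<le> integral {r..r'} ?h" using int(2)[of r r'] r r' by auto
    finally have "Suc m \<le> integral {L..r} ?h + integral {r..r'} ?h" using r by simp
    also have "\<dots> = integral {L..r'} ?h"
      using r r' int(1)[of L r'] by (intro Henstock_Kurzweil_Integration.integral_combine) auto
    finally show ?case using r r' by (intro bexI[of _ r']) auto
  qed
  then obtain r where r: "r \<in> {L..<R}" "f r = y N" "N \<le> integral {L..r} ?h" by blast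
  \<comment> \<open>The stretch from \<open>r\<close> to \<open>R\<close> is left over and has a
    positive integral, so the whole integral exceeds \<open>N\<close>, although \<open>N\<close> was
    obtained by rounding it up.\<close>
  have "0 < g r * ln (f r / f R)"
    using r g_pos yN fR by (intro mult_pos_pos ln_gt_zero) auto
  also have "\<dots> \<le> integral {r..R} ?h" using int(2)[of r R] r by auto
  finally have "N < integral {L..r} ?h + integral {r..R} ?h" using r by simp
  also have "\<dots> = integral {L..R} ?h"
    using r int(1)[of L R] by (intro Henstock_Kurzweil_Integration.integral_combine) auto
  also have "\<dots> \<le> N" unfolding N_def by linarith
  finally show False by simp
qed

text \<open>Subtracting \<open>m / 2\<close> from \<open>X\<close> leaves the mean
  \<open>m / 2\<close>. Where \<open>X s\<close> is at least \<open>m / 2\<close>, monotonicity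
  replaces \<open>k (m / 2)\<close> by \<open>k (X s)\<close>; elsewhere the shifted term is at most
  0.\<close>

lemma sum_weighted_ge_half_mean:
  fixes k :: "real \<Rightarrow> real"
  assumes "finite S" and w: "\<And>s. s \<in> S \<Longrightarrow> 0 \<le> w s" "sum w S = 1"
    and X: "\<And>s. s \<in> S \<Longrightarrow> 0 \<le> X s \<and> X s \<le> M"
    and k_mono: "mono_on {0<..M} k" and k_nonneg: "\<And>x. x \<in> {0<..M} \<Longrightarrow> 0 \<le> k x"
    and m: "m = (\<Sum>s\<in>S. w s * X s)" "0 < m" "m \<le> M"
  shows "m / 2 * k (m / 2) \<le> (\<Sum>s\<in>S. w s * (X s * k (X s)))"
proof -
  have k0: "0 \<le> k (m / 2)" using m by (intro k_nonneg) auto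
  have "(\<Sum>s\<in>S. w s * (X s - m / 2)) = m - sum w S * (m / 2)"
    by (simp only: right_diff_distrib sum_subtractf m(1) sum_distrib_right)
  then have "m / 2 = (\<Sum>s\<in>S. w s * (X s - m / 2))"
    using w(2) by simp
  from arg_cong[OF this, of "\<lambda>z. z * k (m / 2)"]
  have "m / 2 * k (m / 2) = (\<Sum>s\<in>S. w s * ((X s - m / 2) * k (m / 2)))"
    by (simp only: sum_distrib_right mult.assoc)
  also have "\<dots> \<le> (\<Sum>s\<in>S. w s * (X s * k (X s)))"
  proof (intro sum_mono mult_left_mono w)
    fix s assume s: "s \<in> S"
    show "(X s - m / 2) * k (m / 2) \<le> X s * k (X s)"
    proof (cases "m / 2 \<le> X s")
      case True
      then have "k (m / 2) \<le> k (X s)"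
        using X[OF s] m by (intro monotone_onD[OF k_mono]) auto
      then have "(X s - m / 2) * k (m / 2) \<le> X s * k (m / 2)" "X s * k (m / 2) \<le> X s * k (X s)"
        using X[OF s] m k0 by (auto intro!: mult_right_mono mult_left_mono)
      then show ?thesis by linarith
    next
      case False
      then have "(X s - m / 2) * k (m / 2) \<le> 0" using k0 by (intro mult_nonpos_nonneg) auto
      \<comment> \<open>The sign of \<open>k\<close> is known at positive arguments only; at
        \<open>X s = 0\<close> the product vanishes.\<close>
      also have "0 \<le> X s * k (X s)"
        using X[OF s] k_nonneg[of "X s"] by (cases "X s = 0") auto
      finally show ?thesis .
    qed
  qed
  finally show ?thesis .
qed

section \<open>The evolving set process and its Doob transform\<close>

locale stationary_chain =
  fixes P :: "'a::finite \<Rightarrow> 'a \<Rightarrow> real" and \<pi> :: "'a \<Rightarrow> real"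
  assumes kernel: "markov_kernel P"
    and irreducible: "irreducible_kernel P"
    and stationary: "stationary_distribution P \<pi>"
begin

section \<open>Positivity and total mass of the stationary distribution\<close>

lemma P_nonneg: "0 \<le> P x y"
  using kernel by (simp add: markov_kernel_def)

lemma sum_P: "(\<Sum>y\<in>UNIV. P x y) = 1"
  using kernel by (simp add: markov_kernel_def)

lemma sum_\<pi>_P: "(\<Sum>x\<in>UNIV. \<pi> x * P x y) = \<pi> y"
  using stationary by (simp add: stationary_distribution_def)

lemma sum_\<pi>: "sum \<pi> UNIV = 1"
  using stationary by (simp add: stationary_distribution_def)

lemma \<pi>_nonneg: "0 \<le> \<pi> x"
  using stationary by (simp add: stationary_distribution_def)

lemma kernel_pow_nonneg:
  fixes K :: "'s::finite \<Rightarrow> 's \<Rightarrow> real"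
  assumes "\<And>x y. 0 \<le> K x y"
  shows "0 \<le> kernel_pow K n x y"
  by (induction n arbitrary: y) (auto intro!: sum_nonneg mult_nonneg_nonneg assms)

lemma sum_\<pi>_kernel_pow: "(\<Sum>x\<in>UNIV. \<pi> x * kernel_pow P n x y) = \<pi> y"
proof (induction n arbitrary: y)
  case (Suc n)
  have "(\<Sum>x\<in>UNIV. \<pi> x * kernel_pow P (Suc n) x y)
      = (\<Sum>z\<in>UNIV. (\<Sum>x\<in>UNIV. \<pi> x * kernel_pow P n x z) * P z y)"
    unfolding kernel_pow.simps sum_distrib_left sum_distrib_right
    by (subst sum.swap) (simp add: mult.assoc)
  then show ?case by (simp add: Suc sum_\<pi>_P)
qed (simp add: if_distrib cong: if_cong)

text \<open>Some state has positive mass, and irreducibility carries part of it to \<open>y\<close>,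
  since \<open>\<pi>\<close> is stationary for every power of \<open>P\<close>.\<close>

lemma \<pi>_pos: "0 < \<pi> y"
proof -
  have "\<exists>x. \<pi> x \<noteq> 0" using sum_\<pi> by (metis sum.neutral zero_neq_one)
  then obtain x where x: "0 < \<pi> x" using \<pi>_nonneg by (metis less_eq_real_def)
  obtain n where n: "0 < kernel_pow P n x y"
    using irreducible by (auto simp: irreducible_kernel_def)
  have "0 < \<pi> x * kernel_pow P n x y" using x n by simp
  also have "\<dots> \<le> (\<Sum>x\<in>UNIV. \<pi> x * kernel_pow P n x y)"
    by (rule member_le_sum) (auto intro!: mult_nonneg_nonneg \<pi>_nonneg kernel_pow_nonneg P_nonneg)
  finally show ?thesis by (simp add: sum_\<pi>_kernel_pow)
qed

lemma min_mass_pos: "0 < min_mass \<pi>"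
  by (simp add: min_mass_def \<pi>_pos)

lemma min_mass_le_mass: "A \<noteq> {} \<Longrightarrow> min_mass \<pi> \<le> sum \<pi> A"
proof -
  assume "A \<noteq> {}"
  then obtain x where "x \<in> A" by auto
  have "min_mass \<pi> \<le> \<pi> x" by (simp add: min_mass_def)
  also have "\<dots> \<le> sum \<pi> A" using \<open>x \<in> A\<close> by (intro member_le_sum) (auto simp: \<pi>_nonneg)
  finally show ?thesis .
qed

lemma mass_le_1: "sum \<pi> A \<le> 1"
  unfolding sum_\<pi>[symmetric] by (intro sum_mono2) (auto simp: \<pi>_nonneg)

lemma mass_less_1:
  assumes "A \<noteq> UNIV" shows "sum \<pi> A < 1"
proof -
  obtain x where "x \<notin> A" using assms by auto
  then have "sum \<pi> A < sum \<pi> UNIV"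
    by (intro sum_strict_mono2[of _ _ x]) (auto simp: \<pi>_pos \<pi>_nonneg)
  then show ?thesis by (simp add: sum_\<pi>)
qed

lemma mass_pos: "A \<noteq> {} \<Longrightarrow> 0 < sum \<pi> A"
  by (intro sum_pos) (auto simp: \<pi>_pos)

section \<open>The flow and the evolving set kernel\<close>

lemma flow_nonneg: "0 \<le> flow P \<pi> A B"
  by (auto simp: flow_def intro!: sum_nonneg mult_nonneg_nonneg \<pi>_nonneg P_nonneg)

lemma flow_UNIV: "flow P \<pi> UNIV {y} = \<pi> y"
  by (simp add: flow_def sum_\<pi>_P)

lemma flow_le: "flow P \<pi> A {y} \<le> \<pi> y"
proof -
  have "flow P \<pi> A {y} \<le> flow P \<pi> UNIV {y}"
    unfolding flow_def by (intro sum_mono2) (auto intro!: mult_nonneg_nonneg \<pi>_nonneg P_nonneg)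
  then show ?thesis by (simp add: flow_UNIV)
qed

lemma sum_flow: "(\<Sum>y\<in>UNIV. flow P \<pi> A {y}) = sum \<pi> A"
proof -
  have "(\<Sum>y\<in>UNIV. flow P \<pi> A {y}) = (\<Sum>x\<in>A. \<pi> x * (\<Sum>y\<in>UNIV. P x y))"
    unfolding flow_def sum_distrib_left by (subst sum.swap) simp
  then show ?thesis by (simp add: sum_P)
qed

text \<open>The level set is cut out by finitely many half-line conditions. Measurability makes the
  kernel the length of this set within \<open>{0..1}\<close>.\<close>

lemma evolve_level_set_borel: "{u. evolve P \<pi> A u = S} \<in> sets borel"
proof -
  have "{u \<in> space borel. \<forall>y\<in>UNIV. (u * \<pi> y \<le> flow P \<pi> A {y}) = (y \<in> S)} \<in> sets borel"
    by measurable
  also have "{u \<in> space borel. \<forall>y\<in>UNIV. (u * \<pi> y \<le> flow P \<pi> A {y}) = (y \<in> S)}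
      = {u. evolve P \<pi> A u = S}"
    by (auto simp: evolve_def)
  finally show ?thesis .
qed

lemma evolving_set_kernel_eq:
  "evolving_set_kernel P \<pi> A S = measure lborel ({u. evolve P \<pi> A u = S} \<inter> {0..1})"
  using evolve_level_set_borel[of A S]
  by (simp add: evolving_set_kernel_def measure_uniform_measure Int_commute)

text \<open>Only finitely many sets can arise, so the integrand is a finite combination of
  indicators of level sets.\<close>

lemma has_integral_evolve:
  "((\<lambda>u. h (evolve P \<pi> A u)) has_integral (\<Sum>S\<in>UNIV. evolving_set_kernel P \<pi> A S * h S)) {0..1}"
  for h :: "'a set \<Rightarrow> real"
proof -
  have "((\<lambda>u. if u \<in> {u. evolve P \<pi> A u = S} then 1 else 0)
      has_integral evolving_set_kernel P \<pi> A S) {0..1}" for S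
    unfolding has_integral_restrict_Int evolving_set_kernel_eq
  proof (rule has_integral_measure_lborel)
    have "emeasure lborel ({u. evolve P \<pi> A u = S} \<inter> {0..1}) \<le> emeasure lborel {0..1::real}"
      by (intro emeasure_mono) auto
    then show "emeasure lborel ({u. evolve P \<pi> A u = S} \<inter> {0..1}) < \<infinity>"
      by (simp add: order_le_less_trans)
  qed (use evolve_level_set_borel in auto)
  then have "((\<lambda>u. \<Sum>S\<in>UNIV. (if u \<in> {u. evolve P \<pi> A u = S} then 1 else 0) * h S)
      has_integral (\<Sum>S\<in>UNIV. evolving_set_kernel P \<pi> A S * h S)) {0..1}"
    by (intro has_integral_sum has_integral_mult_left) auto
  then show ?thesis by (simp add: if_distrib[of "\<lambda>z. z * _"] cong: if_cong)
qed

text \<open>The mass is a martingale: \<open>y\<close> joins the evolved set with probability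
  \<open>flow P \<pi> A {y} / \<pi> y\<close>, and the flows out of \<open>A\<close> add up to its
  mass. This is why the Doob transform is stochastic on nonempty sets.\<close>

lemma sum_evolving_set_kernel_mass:
  "(\<Sum>S\<in>UNIV. evolving_set_kernel P \<pi> A S * sum \<pi> S) = sum \<pi> A"
proof -
  have level: "((\<lambda>u. if u \<in> {..flow P \<pi> A {y} / \<pi> y} then \<pi> y else 0) has_integral flow P \<pi> A {y}) {0..1}" for y
  proof -
    have "0 \<le> flow P \<pi> A {y} / \<pi> y" "flow P \<pi> A {y} / \<pi> y \<le> 1"
      using flow_nonneg flow_le[of A y] \<pi>_pos[of y] by (auto simp: divide_le_eq)
    then have "{..flow P \<pi> A {y} / \<pi> y} \<inter> {0..1} = {0..flow P \<pi> A {y} / \<pi> y}" by auto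
    then show ?thesis
      unfolding has_integral_restrict_Int
      using has_integral_const_real[of "\<pi> y" 0 "flow P \<pi> A {y} / \<pi> y"] \<pi>_pos[of y] flow_nonneg[of A "{y}"]
      by simp
  qed
  have "sum \<pi> (evolve P \<pi> A u) = (\<Sum>y\<in>UNIV. if u \<in> {..flow P \<pi> A {y} / \<pi> y} then \<pi> y else 0)" for u
    by (simp add: evolve_def pos_le_divide_eq \<pi>_pos flip: sum.inter_filter)
  then have "((\<lambda>u. sum \<pi> (evolve P \<pi> A u)) has_integral (\<Sum>y\<in>UNIV. flow P \<pi> A {y})) {0..1}"
    by (simp only:) (intro has_integral_sum level finite)
  then show ?thesis
    using has_integral_unique[OF has_integral_evolve[of "sum \<pi>"]] by (simp add: sum_flow)
qed

section \<open>The Doob transform and its powers\<close>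

lemma doob_kernel_nonneg: "0 \<le> doob_kernel P \<pi> S S'"
  by (auto simp: doob_kernel_def evolving_set_kernel_def intro!: mult_nonneg_nonneg divide_nonneg_nonneg sum_nonneg \<pi>_nonneg)

text \<open>The factor \<open>sum \<pi> S'\<close> of the Doob weights moves into the integrand,
  which is how the function \<open>a * f a\<close> of the congestion arises.\<close>

lemma sum_doob_kernel:
  "(\<Sum>S'\<in>UNIV. doob_kernel P \<pi> S S' * h (sum \<pi> S'))
    = integral {0..1} (\<lambda>u. sum \<pi> (evolve P \<pi> S u) * h (sum \<pi> (evolve P \<pi> S u))) / sum \<pi> S"
proof -
  have "integral {0..1} (\<lambda>u. sum \<pi> (evolve P \<pi> S u) * h (sum \<pi> (evolve P \<pi> S u)))
      = (\<Sum>S'\<in>UNIV. evolving_set_kernel P \<pi> S S' * (sum \<pi> S' * h (sum \<pi> S')))"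
    by (rule integral_unique[OF has_integral_evolve[of "\<lambda>S. sum \<pi> S * h (sum \<pi> S)"]])
  then show ?thesis
    by (simp add: doob_kernel_def ac_simps flip: sum_divide_distrib)
qed

lemma sum_doob_kernel_1:
  assumes "S \<noteq> {}" shows "(\<Sum>S'\<in>UNIV. doob_kernel P \<pi> S S') = 1"
proof -
  have "(\<Sum>S'\<in>UNIV. doob_kernel P \<pi> S S') = (\<Sum>S'\<in>UNIV. evolving_set_kernel P \<pi> S S' * sum \<pi> S') / sum \<pi> S"
    by (simp add: doob_kernel_def ac_simps flip: sum_divide_distrib)
  then show ?thesis using mass_pos[OF assms] by (simp add: sum_evolving_set_kernel_mass)
qed

lemma doob_kernel_pow_nonneg: "0 \<le> kernel_pow (doob_kernel P \<pi>) n S S'"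
  by (intro kernel_pow_nonneg doob_kernel_nonneg)

lemma doob_kernel_pow_empty: "S \<noteq> {} \<Longrightarrow> kernel_pow (doob_kernel P \<pi>) n S {} = 0"
  by (cases n) (auto simp: doob_kernel_def)

lemma sum_doob_kernel_pow:
  assumes "S \<noteq> {}" shows "(\<Sum>S'\<in>UNIV. kernel_pow (doob_kernel P \<pi>) n S S') = 1"
proof (induction n)
  case (Suc n)
  have "(\<Sum>S'\<in>UNIV. kernel_pow (doob_kernel P \<pi>) (Suc n) S S')
      = (\<Sum>T\<in>UNIV. kernel_pow (doob_kernel P \<pi>) n S T * (\<Sum>S'\<in>UNIV. doob_kernel P \<pi> T S'))"
    unfolding kernel_pow.simps sum_distrib_left by (rule sum.swap)
  \<comment> \<open>The row of \<open>{}\<close> does not sum to 1, but \<open>{}\<close> carries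
    weight 0.\<close>
  also have "\<dots> = (\<Sum>T\<in>UNIV. kernel_pow (doob_kernel P \<pi>) n S T)"
    using assms by (intro sum.cong) (metis doob_kernel_pow_empty sum_doob_kernel_1 mult.right_neutral mult_zero_left)+
  finally show ?case using Suc by simp
qed (use assms in simp)

lemma doob_expectation_Suc:
  "doob_expectation P \<pi> (Suc n) S h
    = (\<Sum>T\<in>UNIV. kernel_pow (doob_kernel P \<pi>) n S T * (\<Sum>S'\<in>UNIV. doob_kernel P \<pi> T S' * h S'))"
  unfolding doob_expectation_def kernel_pow.simps sum_distrib_left sum_distrib_right
  by (subst sum.swap) (simp add: mult.assoc)

lemma evolve_UNIV: "u \<le> 1 \<Longrightarrow> evolve P \<pi> UNIV u = UNIV"
  using \<pi>_pos by (auto simp: evolve_def flow_UNIV less_imp_le)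

lemma doob_step_congestion:
  assumes "f 1 = 0" and f_pos: "\<And>a. a \<in> {0<..<1} \<Longrightarrow> 0 < f a" and "S \<noteq> {}"
  shows "(\<Sum>S'\<in>UNIV. doob_kernel P \<pi> S S' * f (sum \<pi> S'))
    = f (sum \<pi> S) * congestion P \<pi> (\<lambda>a. a * f a) S"
proof (cases "S = UNIV")
  case True
  \<comment> \<open>\<open>UNIV\<close> is absorbing and \<open>f 1 = 0\<close>, so both sides
    vanish; the congestion of \<open>UNIV\<close> is a quotient by zero, multiplied here by
    zero.\<close>
  have "integral {0..1} (\<lambda>u. sum \<pi> (evolve P \<pi> S u) * f (sum \<pi> (evolve P \<pi> S u))) = integral {0..1::real} (\<lambda>u. 0)"
    using assms(1) True by (intro integral_cong) (simp add: evolve_UNIV sum_\<pi>)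
  then show ?thesis using True assms(1) by (simp add: sum_doob_kernel sum_\<pi>)
next
  case False
  then have "f (sum \<pi> S) \<noteq> 0"
    using f_pos[of "sum \<pi> S"] mass_pos[of S] mass_less_1[of S] assms(3) by auto
  then show ?thesis by (simp add: sum_doob_kernel congestion_def)
qed

section \<open>The congestion profile\<close>

definition proper_sets :: "real \<Rightarrow> 'a set set" where
  "proper_sets r = {A. sum \<pi> A \<le> r \<and> A \<noteq> {} \<and> A \<noteq> UNIV}"

lemma congestion_profile_eq: "congestion_profile P \<pi> g r = Max (congestion P \<pi> g ` proper_sets r)"
  unfolding congestion_profile_def proper_sets_def by (rule arg_cong[of _ _ Max]) auto

lemma congestion_le_profile:
  "A \<noteq> {} \<Longrightarrow> A \<noteq> UNIV \<Longrightarrow> sum \<pi> A \<le> r \<Longrightarrow> congestion P \<pi> g A \<le> congestion_profile P \<pi> g r"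
  unfolding congestion_profile_eq by (intro Max_ge) (auto simp: proper_sets_def)

context
  assumes min_mass_less_1: "min_mass \<pi> < 1"
begin

text \<open>A state of least mass forms a proper set because its mass is below 1. Hence the
  \<open>Max\<close> in the profile is attained.\<close>

lemma proper_sets_nonempty:
  assumes "min_mass \<pi> \<le> r" shows "proper_sets r \<noteq> {}"
proof -
  obtain x where x: "\<pi> x = min_mass \<pi>"
    using Min_in[of "range \<pi>"] unfolding min_mass_def image_iff by auto
  have "sum \<pi> {x} \<noteq> sum \<pi> UNIV" using x sum_\<pi> min_mass_less_1 by simp
  then have "{x} \<noteq> UNIV" by metis
  then have "{x} \<in> proper_sets r" using x assms by (simp add: proper_sets_def)
  then show ?thesis by blast
qed

lemma congestion_profile_in:
  assumes "min_mass \<pi> \<le> r"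
  shows "\<exists>A\<in>proper_sets r. congestion_profile P \<pi> g r = congestion P \<pi> g A"
proof -
  have "congestion_profile P \<pi> g r \<in> congestion P \<pi> g ` proper_sets r"
    unfolding congestion_profile_eq using proper_sets_nonempty[OF assms] by (intro Max_in) auto
  then show ?thesis by (rule imageE) blast
qed

text \<open>A larger bound admits more sets. Below \<open>min_mass \<pi>\<close> there are none and
  the profile is unspecified, hence the restricted domain.\<close>

lemma congestion_profile_mono: "mono_on {min_mass \<pi>..} (congestion_profile P \<pi> g)"
proof (rule monotone_onI)
  fix r s assume "r \<in> {min_mass \<pi>..}" "r \<le> s"
  moreover from this obtain A where "A \<in> proper_sets r" "congestion_profile P \<pi> g r = congestion P \<pi> g A"
    using congestion_profile_in[of r g] by auto
  ultimately show "congestion_profile P \<pi> g r \<le> congestion_profile P \<pi> g s"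
    using congestion_le_profile[of A s g] unfolding proper_sets_def by simp
qed

text \<open>Finiteness supplies the substitute weight at the right end of the integral and, in the
  convex case, the constancy of the profile.\<close>

lemma finite_congestion_profile: "finite (congestion_profile P \<pi> g ` {min_mass \<pi>..})"
proof (rule finite_subset)
  show "congestion_profile P \<pi> g ` {min_mass \<pi>..} \<subseteq> range (congestion P \<pi> g)"
    using congestion_profile_in by (metis atLeast_iff image_subsetI rangeI)
qed simp

end

end

section \<open>Mixing time bounds\<close>

text \<open>\<open>min_mass_less_1\<close> excludes the one-point space, which has no proper sets;
  \<open>f_inv_defined\<close> makes \<open>unit_inv f\<close> meaningful at every positive value
  that the expectation can take.\<close>

locale evolving_set_bound = stationary_chain +
  fixes f :: "real \<Rightarrow> real"
  assumes f_nonneg: "\<And>a. a \<in> {0<..1} \<Longrightarrow> 0 \<le> f a"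
    and f_decreasing: "strict_antimono_on {0<..1} f"
    and f_differentiable: "\<And>a. a \<in> {0<..<1} \<Longrightarrow> f differentiable (at a)"
    and f_inv_defined: "{0<..f (min_mass \<pi>)} \<subseteq> f ` {0<..1}"
    and min_mass_less_1: "min_mass \<pi> < 1"
begin

abbreviation C :: "real \<Rightarrow> real" where
  "C \<equiv> congestion_profile P \<pi> (\<lambda>a. a * f a)"

abbreviation E :: "'a \<Rightarrow> nat \<Rightarrow> real" where
  "E x n \<equiv> doob_expectation P \<pi> n {x} (\<lambda>S. f (sum \<pi> S))"

section \<open>The function \<open>f\<close> and its inverse\<close>

lemma f_less: "0 < a \<Longrightarrow> a < b \<Longrightarrow> b \<le> 1 \<Longrightarrow> f b < f a"
  using monotone_onD[OF f_decreasing, of a b] by auto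

lemma f_le: "0 < a \<Longrightarrow> a \<le> b \<Longrightarrow> b \<le> 1 \<Longrightarrow> f b \<le> f a"
  using f_less[of a b] by (cases "a = b") auto

text \<open>If \<open>f 1\<close> were positive, \<open>f 1 / 2\<close> would need a preimage by
  \<open>f_inv_defined\<close>, yet \<open>f 1\<close> is the least value.\<close>

lemma f_1: "f 1 = 0"
proof (rule ccontr)
  assume "f 1 \<noteq> 0"
  then have pos: "0 < f 1" using f_nonneg[of 1] by auto
  have "f 1 \<le> f (min_mass \<pi>)"
    using min_mass_less_1 min_mass_pos by (intro f_le) auto
  then have "f 1 / 2 \<in> {0<..f (min_mass \<pi>)}" using pos by auto
  then obtain a where "a \<in> {0<..1}" "f a = f 1 / 2" using f_inv_defined by (metis imageE subsetD)
  then show False using f_le[of a 1] pos by auto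
qed

lemma f_pos: "a \<in> {0<..<1} \<Longrightarrow> 0 < f a"
  using f_less[of a 1] f_1 by auto

lemma inj_on_f: "inj_on f {0<..1}"
proof (rule linorder_inj_onI')
  fix a b :: real assume "a \<in> {0<..1}" "b \<in> {0<..1}" "a < b"
  then show "f a \<noteq> f b" using f_less[of a b] by auto
qed

lemma unit_inv_f: "a \<in> {0<..1} \<Longrightarrow> unit_inv f (f a) = a"
  unfolding unit_inv_def by (rule the_inv_into_f_f[OF inj_on_f])

lemma unit_inv_props:
  assumes "x \<in> f ` {0<..1}" "0 < x"
  shows "f (unit_inv f x) = x" "unit_inv f x \<in> {0<..<1}"
proof -
  obtain a where a: "a \<in> {0<..1}" "x = f a" using assms by auto
  moreover have "a \<noteq> 1" using a assms f_1 by auto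
  ultimately show "f (unit_inv f x) = x" "unit_inv f x \<in> {0<..<1}"
    by (auto simp: unit_inv_f)
qed

lemma unit_inv_mono:
  assumes "x \<in> f ` {0<..1}" "y \<in> f ` {0<..1}" "x \<le> y"
  shows "unit_inv f y \<le> unit_inv f x"
proof -
  obtain a b where "a \<in> {0<..1}" "x = f a" "b \<in> {0<..1}" "y = f b" using assms by auto
  moreover have "\<not> a < b" using calculation f_less[of a b] assms(3) by auto
  ultimately show ?thesis by (simp add: unit_inv_f)
qed

text \<open>Keeps the argument of \<open>C\<close> where the profile is a maximum over a nonempty
  family.\<close>

lemma unit_inv_ge_min_mass:
  assumes "x \<in> {0<..f (min_mass \<pi>)}"
  shows "min_mass \<pi> \<le> unit_inv f x"
  using unit_inv_mono[of x "f (min_mass \<pi>)"] f_inv_defined assms min_mass_pos min_mass_less_1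
  by (auto simp: unit_inv_f)

lemma unit_inv_mass:
  "S \<noteq> {} \<Longrightarrow> unit_inv f (f (sum \<pi> S)) = sum \<pi> S"
  using mass_pos mass_le_1 by (intro unit_inv_f) auto

lemma f_mass:
  "S \<noteq> {} \<Longrightarrow> 0 \<le> f (sum \<pi> S)" "S \<noteq> {} \<Longrightarrow> f (sum \<pi> S) \<le> f (min_mass \<pi>)"
  using mass_pos[of S] mass_le_1[of S] min_mass_le_mass[of S] min_mass_pos
  by (auto intro: f_nonneg f_le)

section \<open>One-step bounds for the Doob expectation\<close>

definition w :: "'a \<Rightarrow> nat \<Rightarrow> 'a set \<Rightarrow> real" where
  "w x n = kernel_pow (doob_kernel P \<pi>) n {x}"

lemma w_nonneg: "0 \<le> w x n S"
  by (simp add: w_def doob_kernel_pow_nonneg)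

lemma sum_UNIV_w: "(\<Sum>S\<in>UNIV. w x n S * h S) = (\<Sum>S\<in>-{{}}. w x n S * h S)"
  by (rule sum.mono_neutral_right) (auto simp: w_def doob_kernel_pow_empty)

lemma sum_w: "sum (w x n) (-{{}}) = 1"
  using sum_UNIV_w[of x n "\<lambda>_. 1"] by (simp add: w_def sum_doob_kernel_pow)

lemma E_eq: "E x n = (\<Sum>S\<in>-{{}}. w x n S * f (sum \<pi> S))"
  unfolding doob_expectation_def w_def[symmetric] by (rule sum_UNIV_w)

lemma E_nonneg: "0 \<le> E x n"
  unfolding E_eq by (auto intro!: sum_nonneg mult_nonneg_nonneg w_nonneg f_mass)

lemma E_le: "E x n \<le> f (min_mass \<pi>)"
proof -
  have "E x n \<le> (\<Sum>S\<in>-{{}}. w x n S * f (min_mass \<pi>))"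
    unfolding E_eq by (auto intro!: sum_mono mult_left_mono w_nonneg f_mass)
  then show ?thesis by (simp add: sum_w flip: sum_distrib_right)
qed

abbreviation k :: "real \<Rightarrow> real" where
  "k y \<equiv> 1 - C (unit_inv f y)"

text \<open>The loss in one step stays an expectation under the law \<open>w x n\<close>, so that
  the convex and the general case can bound it in different ways.\<close>

lemma E_Suc_le: "E x (Suc n) \<le> E x n - (\<Sum>S\<in>-{{}}. w x n S * (f (sum \<pi> S) * k (f (sum \<pi> S))))"
proof -
  have "E x (Suc n) = (\<Sum>S\<in>-{{}}. w x n S * (\<Sum>S'\<in>UNIV. doob_kernel P \<pi> S S' * f (sum \<pi> S')))"
    unfolding doob_expectation_Suc w_def[symmetric] by (rule sum_UNIV_w)
  also have "\<dots> \<le> (\<Sum>S\<in>-{{}}. w x n S * (f (sum \<pi> S) * C (sum \<pi> S)))"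
  proof (intro sum_mono mult_left_mono w_nonneg)
    fix S :: "'a set" assume S: "S \<in> -{{}}"
    have "(\<Sum>S'\<in>UNIV. doob_kernel P \<pi> S S' * f (sum \<pi> S')) = f (sum \<pi> S) * congestion P \<pi> (\<lambda>a. a * f a) S"
      using S by (intro doob_step_congestion f_1 f_pos) auto
    \<comment> \<open>The profile bounds proper sets only; for \<open>UNIV\<close> both sides are 0
      since \<open>f 1 = 0\<close>.\<close>
    also have "\<dots> \<le> f (sum \<pi> S) * C (sum \<pi> S)"
      using S f_1 f_mass(1)[of S] congestion_le_profile[of S "sum \<pi> S" "\<lambda>a. a * f a"]
      by (cases "S = UNIV") (auto simp: sum_\<pi> intro: mult_left_mono)
    finally show "(\<Sum>S'\<in>UNIV. doob_kernel P \<pi> S S' * f (sum \<pi> S')) \<le> f (sum \<pi> S) * C (sum \<pi> S)" .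
  qed
  also have "\<dots> = (\<Sum>S\<in>-{{}}. w x n S * f (sum \<pi> S) - w x n S * (f (sum \<pi> S) * k (f (sum \<pi> S))))"
    by (intro sum.cong) (auto simp: unit_inv_mass algebra_simps)
  finally show ?thesis by (simp add: sum_subtractf E_eq)
qed

text \<open>Jensen's inequality under the law \<open>w x n\<close>. The interval contains 0, the
  value of \<open>f (sum \<pi> S)\<close> at \<open>S = UNIV\<close>.\<close>

lemma E_Suc_le_convex:
  assumes "convex_on {0..f (min_mass \<pi>)} (\<lambda>y. y * k y)"
  shows "E x (Suc n) \<le> E x n - E x n * k (E x n)"
proof -
  have ne: "-{{}} \<noteq> ({} :: 'a set set)" by auto
  have "E x n * k (E x n) \<le> (\<Sum>S\<in>-{{}}. w x n S * (f (sum \<pi> S) * k (f (sum \<pi> S))))"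
    using convex_on_sum[OF _ ne assms sum_w[of x n], of "\<lambda>S. f (sum \<pi> S)"]
    by (auto simp: E_eq w_nonneg f_mass)
  then show ?thesis using E_Suc_le[of n x] by linarith
qed

lemma k_mono: "mono_on {0<..f (min_mass \<pi>)} k"
proof (rule monotone_onI)
  fix y z assume yz: "y \<in> {0<..f (min_mass \<pi>)}" "z \<in> {0<..f (min_mass \<pi>)}" "y \<le> z"
  then have "unit_inv f z \<le> unit_inv f y" using f_inv_defined by (intro unit_inv_mono) auto
  then have "C (unit_inv f z) \<le> C (unit_inv f y)"
    using yz unit_inv_ge_min_mass by (intro monotone_onD[OF congestion_profile_mono[OF min_mass_less_1]]) auto
  then show "k y \<le> k z" by simp
qed

lemma congestion_profile_le_1:
  assumes "\<forall>A. A \<noteq> {} \<and> A \<noteq> UNIV \<longrightarrow> congestion P \<pi> (\<lambda>a. a * f a) A \<le> 1" "min_mass \<pi> \<le> r"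
  shows "C r \<le> 1"
  using congestion_profile_in[OF min_mass_less_1 assms(2), of "\<lambda>a. a * f a"] assms(1)
  by (auto simp: proper_sets_def)

text \<open>The bound on congestions makes \<open>k\<close> nonnegative at positive arguments, so
  the loss is nonnegative and the half-mean inequality applies to it.\<close>

lemma E_Suc_le_general:
  assumes C_le: "\<forall>A. A \<noteq> {} \<and> A \<noteq> UNIV \<longrightarrow> congestion P \<pi> (\<lambda>a. a * f a) A \<le> 1"
  shows "E x (Suc n) \<le> E x n"
    and "0 < E x n \<Longrightarrow> E x (Suc n) \<le> E x n - E x n / 2 * k (E x n / 2)"
proof -
  have k_nonneg: "0 \<le> k y" if "y \<in> {0<..f (min_mass \<pi>)}" for y
    using congestion_profile_le_1[OF C_le unit_inv_ge_min_mass[OF that]] by simp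
  have "0 \<le> (\<Sum>S\<in>-{{}}. w x n S * (f (sum \<pi> S) * k (f (sum \<pi> S))))"
  proof (intro sum_nonneg mult_nonneg_nonneg[OF w_nonneg])
    fix S :: "'a set" assume "S \<in> -{{}}"
    then show "0 \<le> f (sum \<pi> S) * k (f (sum \<pi> S))"
      using f_mass[of S] k_nonneg[of "f (sum \<pi> S)"] by (cases "f (sum \<pi> S) = 0") auto
  qed
  then show "E x (Suc n) \<le> E x n" using E_Suc_le[of n x] by linarith
  assume "0 < E x n"
  then have "E x n / 2 * k (E x n / 2) \<le> (\<Sum>S\<in>-{{}}. w x n S * (f (sum \<pi> S) * k (f (sum \<pi> S))))"
    using k_nonneg E_le[of n x] sum_w f_mass
    by (intro sum_weighted_ge_half_mean[OF _ w_nonneg _ _ k_mono]) (auto simp: E_eq)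
  then show "E x (Suc n) \<le> E x n - E x n / 2 * k (E x n / 2)"
    using E_Suc_le[of n x] by linarith
qed

text \<open>
  The profile takes finitely many values, whereas the convex function \<open>y * k y\<close> is continuous
  inside its interval. Hence \<open>C\<close> is constant on \<open>{min_mass \<pi><..<1}\<close>.
\<close>

lemma convex_profile_less_1:
  assumes conv: "convex_on {0..f (min_mass \<pi>)} (\<lambda>y. y * k y)"
    and R: "min_mass \<pi> < R" "R < 1" and less: "\<forall>r\<in>{min_mass \<pi>..<R}. C r < 1"
    and r: "r \<in> {min_mass \<pi>..<1}"
  shows "C r < 1"
proof (cases "r = min_mass \<pi>")
  case True
  then show ?thesis using less R by auto
next
  case False
  let ?I = "{0<..<f (min_mass \<pi>)}"
  have "convex_on ?I (\<lambda>y. y * k y)"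
    using conv by (rule convex_on_subset) auto
  then have "continuous_on ?I (\<lambda>y. y * k y)"
    by (intro convex_on_continuous) auto
  \<comment> \<open>Dividing by \<open>y\<close> recovers \<open>k\<close>, as 0 lies outside the
    open interval.\<close>
  then have "continuous_on ?I (\<lambda>y. y * k y / y)"
    by (rule continuous_on_divide) (auto intro: continuous_on_id)
  then have "continuous_on ?I k"
    by (rule continuous_on_eq) auto
  moreover have "finite (k ` ?I)"
  proof (rule finite_subset)
    show "k ` ?I \<subseteq> (\<lambda>c. 1 - c) ` C ` {min_mass \<pi>..}"
      using unit_inv_ge_min_mass by force
  qed (use finite_congestion_profile[OF min_mass_less_1] in auto)
  ultimately have "k constant_on ?I"
    by (intro continuous_finite_range_constant) auto
  then obtain c where c: "\<And>y. y \<in> ?I \<Longrightarrow> k y = c" by (auto simp: constant_on_def)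
  have C: "1 - C s = c" if "s \<in> {min_mass \<pi><..<1}" for s
    using c[of "f s"] f_less[of "min_mass \<pi>" s] f_pos[of s] that min_mass_pos unit_inv_f[of s] by auto
  \<comment> \<open>The midpoint lies where \<open>C\<close> is assumed to be below 1; constancy
    carries the bound over to \<open>r\<close>.\<close>
  have "C r = C ((min_mass \<pi> + R) / 2)"
    using C[of r] C[of "(min_mass \<pi> + R) / 2"] r R False by auto
  also have "\<dots> < 1" using less R by auto
  finally show ?thesis .
qed

text \<open>Serves both bounds, with \<open>\<kappa> = 1\<close> in the convex and
  \<open>\<kappa> = 2\<close> in the general case. The scaled sequence
  \<open>E x n / \<kappa>\<close> starts at or below \<open>f L\<close> and shrinks by the factor
  \<open>1 - 1 / g r\<close> with \<open>g = \<kappa> / (1 - C)\<close>, until it reaches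
  \<open>f R\<close>.\<close>

lemma E_decay:
  assumes "0 < \<kappa>" and L: "L \<in> {min_mass \<pi>..<1}" "f L = f (min_mass \<pi>) / \<kappa>"
    and R: "R \<in> {0<..<1}" "f R = \<epsilon> / \<kappa>" and "\<epsilon> < f (min_mass \<pi>)"
    and C_less: "\<forall>r\<in>{min_mass \<pi>..<R}. C r < 1"
    and E_antimono: "\<And>n. E x (Suc n) \<le> E x n"
    and step: "\<And>n. 0 < E x n \<Longrightarrow> E x (Suc n) \<le> E x n - E x n / \<kappa> * k (E x n / \<kappa>)"
  shows "E x (nat \<lceil>integral {L..R} (\<lambda>r. - \<kappa> * deriv f r / (f r * (1 - C r)))\<rceil>) \<le> \<epsilon>"
proof -
  have fRL: "f R < f L" using L R assms(1,6) by (simp add: divide_strict_right_mono)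
  have L0: "0 < L" using L min_mass_pos by auto
  have LR: "L < R" using fRL f_le[of R L] R L by force
  define y where "y n = E x n / \<kappa>" for n
  define g where "g r = \<kappa> / (1 - C r)" for r
  have sub: "{L..<R} \<subseteq> {min_mass \<pi>..}" using L by auto
  have Cr: "C r < 1" if "r \<in> {L..<R}" for r using C_less that L by auto
  have bound: "y (nat \<lceil>integral {L..R} (\<lambda>r. g r * (- deriv f r / f r))\<rceil>) \<le> f R"
  proof (rule decay_time_le_integral[where f = f and g = g and y = y and L = L and R = R])
    show diff: "f differentiable (at r)" if "r \<in> {L<..<R}" for r
      using that L0 R by (intro f_differentiable) auto
    show "continuous_on {L..R} f"
      using L0 R by (intro differentiable_imp_continuous_on)
        (auto simp: differentiable_on_def intro!: differentiable_at_withinI f_differentiable)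
    show "antimono_on {L..R} f" using L0 R by (auto intro!: monotone_onI f_le)
    show "0 < f R" using R by (intro f_pos)
    show "mono_on {L..<R} g"
    proof (rule monotone_onI)
      fix r s assume rs: "r \<in> {L..<R}" "s \<in> {L..<R}" "r \<le> s"
      then have "C r \<le> C s"
        using L by (intro monotone_onD[OF congestion_profile_mono[OF min_mass_less_1]]) auto
      then show "g r \<le> g s"
        unfolding g_def using Cr[of s] rs assms(1) by (intro divide_left_mono mult_pos_pos) auto
    qed
    have "finite (C ` {L..<R})"
      using finite_congestion_profile[OF min_mass_less_1] sub by (rule finite_subset[OF image_mono, rotated])
    then have "finite ((\<lambda>c. \<kappa> / (1 - c)) ` C ` {L..<R})" by blast
    then show "finite (g ` {L..<R})" by (simp add: image_image g_def)
    show "0 < g r" if "r \<in> {L..<R}" for r using Cr[OF that] assms(1) by (simp add: g_def)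
    show "antimono y"
      using E_antimono assms(1) by (auto simp: y_def antimono_iff_le_Suc intro: divide_right_mono)
    show "y 0 \<le> f L" using E_le[of 0 x] assms(1) by (auto simp: y_def L intro: divide_right_mono)
    fix n r assume r: "r \<in> {L..<R}" "f r = y n" "f R < y n"
    have "0 < y n" using r \<open>0 < f R\<close> by linarith
    \<comment> \<open>This identifies \<open>k (y n)\<close> with \<open>1 - C r\<close>.\<close>
    have "unit_inv f (y n) = r" using r L0 R by (auto simp: unit_inv_f simp flip: r(2))
    then have "E x (Suc n) \<le> E x n - y n * (1 - C r)"
      using step[of n] \<open>0 < y n\<close> assms(1) by (simp add: y_def zero_less_divide_iff)
    then have "y (Suc n) \<le> (E x n - y n * (1 - C r)) / \<kappa>"
      using assms(1) by (simp add: y_def divide_right_mono)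
    also have "\<dots> = y n * (1 - 1 / g r)"
      using assms(1) Cr[OF r(1)] by (simp add: y_def g_def field_simps)
    finally show "y (Suc n) \<le> y n * (1 - 1 / g r)" .
  qed (use LR in auto)
  have eq: "(\<lambda>r. g r * (- deriv f r / f r)) = (\<lambda>r. - \<kappa> * deriv f r / (f r * (1 - C r)))"
    by (auto simp: g_def ac_simps)
  show ?thesis
    using bound assms(1) unfolding eq y_def R(2) by (simp add: divide_le_cancel)
qed

end

section \<open>From expectations to the mixing time\<close>

lemma mixing_time_le: "(\<And>x. d (kernel_pow P n x) \<pi> \<le> \<epsilon>) \<Longrightarrow> mixing_time d P \<pi> \<epsilon> \<le> enat n"
  unfolding mixing_time_def by (intro Inf_lower) auto

theorem theorem2p3p4:
  fixes P :: "'a::finite \<Rightarrow> 'a \<Rightarrow> real"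
    and \<pi> :: "'a \<Rightarrow> real"
    and f :: "real \<Rightarrow> real"
    and d :: "('a \<Rightarrow> real) \<Rightarrow> ('a \<Rightarrow> real) \<Rightarrow> real"
    and \<epsilon> :: real
  assumes "markov_kernel P"
    and "irreducible_kernel P"
    and "stationary_distribution P \<pi>"
    and f_nonneg: "\<forall>a\<in>{0<..1}. 0 \<le> f a"
    and f_decreasing: "strict_antimono_on {0<..1} f"
    and f_differentiable: "\<forall>a\<in>{0<..<1}. f differentiable (at a)"
    and f_inv_defined: "{0<..f (min_mass \<pi>)} \<subseteq> f ` {0<..1}"
    and dist_le: "\<forall>x n. d (kernel_pow P n x) \<pi> \<le> doob_expectation P \<pi> n {x} (\<lambda>S. f (sum \<pi> S))"
    and "0 < \<epsilon>"
  shows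
    "(\<epsilon> \<in> f ` {0<..1} \<and>
      (\<forall>r\<in>{min_mass \<pi>..<unit_inv f \<epsilon>}. congestion_profile P \<pi> (\<lambda>a. a * f a) r < 1) \<and>
      convex_on {0..f (min_mass \<pi>)}
        (\<lambda>x. x * (1 - congestion_profile P \<pi> (\<lambda>a. a * f a) (unit_inv f x)))
      \<longrightarrow>
      mixing_time d P \<pi> \<epsilon> \<le>
        enat (nat \<lceil>integral {min_mass \<pi>..unit_inv f \<epsilon>}
          (\<lambda>x. - deriv f x / (f x * (1 - congestion_profile P \<pi> (\<lambda>a. a * f a) x)))\<rceil>))
     \<and>
     (\<epsilon> / 2 \<in> f ` {0<..1} \<and>
      (\<forall>r\<in>{min_mass \<pi>..<unit_inv f (\<epsilon> / 2)}. congestion_profile P \<pi> (\<lambda>a. a * f a) r < 1) \<and>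
      (\<forall>A. A \<noteq> {} \<and> A \<noteq> UNIV \<longrightarrow> congestion P \<pi> (\<lambda>a. a * f a) A \<le> 1)
      \<longrightarrow>
      mixing_time d P \<pi> \<epsilon> \<le>
        enat (nat \<lceil>integral {unit_inv f (f (min_mass \<pi>) / 2)..unit_inv f (\<epsilon> / 2)}
          (\<lambda>x. - 2 * deriv f x / (f x * (1 - congestion_profile P \<pi> (\<lambda>a. a * f a) x)))\<rceil>))"
proof -
  interpret stationary_chain P \<pi> using assms(1-3) by unfold_locales
  let ?p = "min_mass \<pi>"
  show ?thesis
  \<comment> \<open>If \<open>f ?p \<le> \<epsilon>\<close>, zero steps suffice for both bounds,
    because the process starts at a singleton, of mass at least \<open>?p\<close>.\<close>
  proof (cases "f ?p \<le> \<epsilon>")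
    case True
    have "d (kernel_pow P 0 x) \<pi> \<le> \<epsilon>" for x
    proof -
      have "d (kernel_pow P 0 x) \<pi> \<le> f (\<pi> x)"
        using dist_le[rule_format, of 0 x]
        by (simp add: doob_expectation_def if_distrib[of "\<lambda>z. z * _"] cong: if_cong)
      also have "f (\<pi> x) \<le> f ?p"
        using min_mass_le_mass[of "{x}"] mass_le_1[of "{x}"] min_mass_pos monotone_onD[OF f_decreasing, of ?p "\<pi> x"]
        by (cases "\<pi> x = ?p") auto
      finally show ?thesis using True by simp
    qed
    then have "mixing_time d P \<pi> \<epsilon> \<le> enat 0" by (rule mixing_time_le)
    then have "mixing_time d P \<pi> \<epsilon> \<le> enat m" for m by (simp add: zero_enat_def[symmetric])
    then show ?thesis by blast
  next
    case False
    then have \<epsilon>: "\<epsilon> < f ?p" by simp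
    \<comment> \<open>\<open>\<epsilon>\<close> has a preimage under \<open>f\<close>, but for
      \<open>?p = 1\<close> it would lie below \<open>f 1\<close>, the least value of
      \<open>f\<close>.\<close>
    have "?p \<noteq> 1"
    proof
      assume "?p = 1"
      have "\<epsilon> \<in> {0<..f ?p}" using \<epsilon> \<open>0 < \<epsilon>\<close> by simp
      then obtain a where "a \<in> {0<..1}" "f a = \<epsilon>" using f_inv_defined by (metis imageE subsetD)
      then show False using \<epsilon> \<open>?p = 1\<close> monotone_onD[OF f_decreasing, of a 1] by (cases "a = 1") auto
    qed
    then have "?p < 1" using min_mass_le_mass[of UNIV] by (simp add: sum_\<pi>)
    then interpret evolving_set_bound P \<pi> f
      using f_nonneg f_decreasing f_differentiable f_inv_defined by unfold_locales auto
    have mix: "mixing_time d P \<pi> \<epsilon> \<le> enat n" if "\<And>x. E x n \<le> \<epsilon>" for n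
      using that dist_le by (intro mixing_time_le) (meson order_trans)
    show ?thesis
    proof (intro conjI impI; elim conjE)
      let ?R = "unit_inv f \<epsilon>"
      assume in_range: "\<epsilon> \<in> f ` {0<..1}" and less: "\<forall>r\<in>{?p..<?R}. C r < 1"
        and conv: "convex_on {0..f ?p} (\<lambda>y. y * k y)"
      note R = unit_inv_props[OF in_range \<open>0 < \<epsilon>\<close>]
      have "?p < ?R" using f_le[of ?R ?p] R \<epsilon> \<open>?p < 1\<close> by force
      have step: "E x (Suc n) \<le> E x n - E x n / 1 * k (E x n / 1)" for x n
        using E_Suc_le_convex[OF conv] by simp
      \<comment> \<open>\<open>C < 1\<close> is assumed only to the left of \<open>?R\<close>, while
        the expectation may already be at most \<open>\<epsilon>\<close>. Convexity extends the
        bound, so \<open>k\<close> is positive at every positive value of the expectation.\<close>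
      have "E x (Suc n) \<le> E x n" for x n
      proof (cases "E x n = 0")
        case True
        then show ?thesis using step[of n x] by simp
      next
        case False
        then have Ex: "E x n \<in> {0<..f ?p}" using E_nonneg[of n x] E_le[of n x] by simp
        then have "E x n \<in> f ` {0<..1}" "0 < E x n" using f_inv_defined by auto
        note this unit_inv_props[OF this]
        then have "0 < k (E x n)"
          using convex_profile_less_1[OF conv \<open>?p < ?R\<close> _ less, of "unit_inv f (E x n)"] R
            unit_inv_ge_min_mass[OF Ex] by auto
        then show ?thesis using step[of n x] \<open>0 < E x n\<close> by (simp add: order_trans)
      qed
      then have "E x (nat \<lceil>integral {?p..?R} (\<lambda>r. - 1 * deriv f r / (f r * (1 - C r)))\<rceil>) \<le> \<epsilon>" for x
        using R \<epsilon> less step \<open>?p < 1\<close> by (intro E_decay) auto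
      then show "mixing_time d P \<pi> \<epsilon> \<le> enat (nat \<lceil>integral {?p..?R} (\<lambda>r. - deriv f r / (f r * (1 - C r)))\<rceil>)"
        by (intro mix) simp
    next
      let ?L = "unit_inv f (f ?p / 2)" and ?R = "unit_inv f (\<epsilon> / 2)"
      assume in_range: "\<epsilon> / 2 \<in> f ` {0<..1}" and less: "\<forall>r\<in>{?p..<?R}. C r < 1"
        and C_le: "\<forall>A. A \<noteq> {} \<and> A \<noteq> UNIV \<longrightarrow> congestion P \<pi> (\<lambda>a. a * f a) A \<le> 1"
      \<comment> \<open>Since \<open>k\<close> is evaluated at half the expectation, both limits of
        the integral are preimages of halved values.\<close>
      have half: "f ?p / 2 \<in> {0<..f ?p}" using \<epsilon> \<open>0 < \<epsilon>\<close> by auto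
      then have "f ?p / 2 \<in> f ` {0<..1}" "0 < f ?p / 2" using f_inv_defined by auto
      note L = unit_inv_props[OF this] unit_inv_ge_min_mass[OF half]
      have "E x (nat \<lceil>integral {?L..?R} (\<lambda>r. - 2 * deriv f r / (f r * (1 - C r)))\<rceil>) \<le> \<epsilon>" for x
        using L unit_inv_props[OF in_range] \<open>0 < \<epsilon>\<close> \<epsilon> less E_Suc_le_general[OF C_le]
        by (intro E_decay) auto
      then show "mixing_time d P \<pi> \<epsilon> \<le> enat (nat \<lceil>integral {?L..?R} (\<lambda>r. - 2 * deriv f r / (f r * (1 - C r)))\<rceil>)"
        by (rule mix)
    qed
  qed
qed

end
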